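(* Let $n\geq 2$ be an integer. Suppose there exist $p_1<p_2$ in $[1,2n]$, where $p_2$ is a prime and $p_1$ is either a prime or $p_1=1$, such that $2n+p_1$ and $2n+p_2$ are both prime and $\gcd\left(\frac{p_2-p_1}{2},\,n\right)=1$. Then the prime sum graph $G_{2n}$ contains a Hamilton cycle.
   Context: For a positive integer $m$, the prime sum graph $G_m$ is the graph with vertex set $\{1,2,\dots,m\}$ in which two distinct vertices $i,j$ are adjacent if and only if $i+j$ is a prime number. A Hamilton cycle is a cycle visiting every vertex exactly once. *)

theory Defs
  imports "Graph_Theory.Graph_Theory" "HOL-Computational_Algebra.Primes"
begin

text \<open>
  As in \<^theory>\<open>Graph_Theory.Kuratowski\<close>, an undirected simple graph is represented by its
  symmetric loop-free digraph, every edge being a pair of opposite arcs.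
\<close>

definition prime_sum_graph :: "nat \<Rightarrow> nat pair_pre_digraph" where
  "prime_sum_graph m =
    \<lparr> pverts = {1..m},
      parcs = {(i, j). i \<in> {1..m} \<and> j \<in> {1..m} \<and> i \<noteq> j \<and> prime (i + j)} \<rparr>"

lemma pair_graph_prime_sum_graph: "pair_graph (prime_sum_graph m)"
proof -
  have "finite (parcs (prime_sum_graph m))"
    by (rule finite_subset[of _ "{1..m} \<times> {1..m}"]) (auto simp: prime_sum_graph_def)
  then show ?thesis
    by unfold_locales
      (auto simp: prime_sum_graph_def symmetric_def add.commute intro!: symI)
qed

text \<open>
  \<^const>\<open>pre_digraph.cycle\<close> accepts any nonempty closed arc walk without repeated vertices, in
  particular the traversal of a single undirected edge back and forth. The length bound restricts
  it to cycles of an undirected simple graph. That no vertex is visited twice is part of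
  \<^const>\<open>pre_digraph.cycle\<close>; see the lemma below.
\<close>

definition (in pre_digraph) hamilton_cycle :: "'b awalk \<Rightarrow> bool" where
  "hamilton_cycle p \<longleftrightarrow> cycle p \<and> 3 \<le> length p \<and> set (map (tail G) p) = verts G"

lemma (in pre_digraph) hamilton_cycle_distinct:
  assumes "hamilton_cycle p"
  shows "distinct (map (tail G) p)"
proof -
  from assms obtain u where u: "awalk u p u" "distinct (tl (awalk_verts u p))" and ne: "p \<noteq> []"
    by (auto simp: hamilton_cycle_def cycle_def)
  from u(1) have cas: "cas u p u" by (simp add: awalk_def)
  have walk_tails: "awalk_verts u p = map (tail G) p @ [head G (last p)]"
    using ne by (simp add: awalk_verts_conv)
  have walk_heads: "awalk_verts u p = tail G (hd p) # map (head G) p"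
    using ne cas by (simp add: awalk_verts_conv')
  have "head G (last p) = v" if "cas w p v" "p \<noteq> []" for w v
    using that by (induction w p v rule: cas.induct) (auto split: if_splits elim: cas.elims)
  then have "head G (last p) = u"
    using cas ne by blast
  moreover have "tail G (hd p) = u"
    using cas ne by (simp add: cas_simp)
  ultimately have "mset (map (tail G) p) = mset (map (head G) p)"
    using arg_cong[OF trans[OF walk_tails[symmetric] walk_heads], of mset] by simp
  moreover have "distinct (map (head G) p)"
    using u(2) walk_heads by simp
  ultimately show ?thesis
    using mset_eq_imp_distinct_iff by blast
qed

end

theory Submission
  imports Defs "HOL-Number_Theory.Cong"
begin

text \<open>
  Put \<open>d = p\<^sub>2 - p\<^sub>1\<close>. Modulo \<open>2n\<close>, alternate the two reflections \<open>i \<mapsto> p\<^sub>1 - i\<close> and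
  \<open>i \<mapsto> p\<^sub>2 - i\<close>, starting from \<open>0\<close>. Numbers of \<open>{1..2n}\<close> exchanged by a reflection have sum
  \<open>p\<close> or \<open>2n + p\<close>, so they are adjacent. Two consecutive reflections translate by the even
  number \<open>d\<close>; as \<open>d / 2\<close> is coprime to \<open>n\<close>, the orbit runs through all even residues, and the
  intermediate vertices through all odd ones.
\<close>

lemma (in pre_digraph) cas_map_upt:
  assumes "i \<le> m"
    and "\<And>k. k < m \<Longrightarrow> tail G (e k) = x k" "\<And>k. k < m \<Longrightarrow> head G (e k) = x (Suc k)"
  shows "cas (x i) (map e [i..<m]) (x m)"
  using assms(1) by (induction rule: inc_induct) (simp_all add: upt_conv_Cons assms(2,3))

text \<open>\<open>cycle\<close> asks for distinct heads, while \<open>bij\<close> yields distinct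
  tails. By \<open>closed\<close>, the list of heads is the list of tails with its first entry moved
  to the end, so the two have the same multiset.\<close>

lemma (in pre_digraph) hamilton_cycleI:
  assumes m: "3 \<le> m"
    and arcs: "\<And>k. k < m \<Longrightarrow> e k \<in> arcs G"
    and tail: "\<And>k. k < m \<Longrightarrow> tail G (e k) = x k"
    and head: "\<And>k. k < m \<Longrightarrow> head G (e k) = x (Suc k)"
    and closed: "x m = x 0"
    and bij: "bij_betw x {..<m} (verts G)"
  shows "hamilton_cycle (map e [0..<m])"
proof -
  let ?p = "map e [0..<m]"
  have cas: "cas (x 0) ?p (x 0)"
    using cas_map_upt[of 0 m e x] tail head closed by simp
  have tails: "map (tail G) ?p = map x [0..<m]"
    using tail by simp
  have ne: "?p \<noteq> []" using m by simp
  have x0: "x 0 \<in> verts G" using bij m by (auto simp: bij_betw_def)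
  have heads: "tl (awalk_verts (x 0) ?p) = map (\<lambda>k. x (Suc k)) [0..<m]"
    using awalk_verts_conv'[OF cas] ne head by simp
  obtain m' where m': "m = Suc m'" using m by (cases m) auto
  have "map (\<lambda>k. x (Suc k)) [0..<m] = map x [Suc 0..<Suc m]"
    by (simp add: map_Suc_upt[symmetric] del: upt_Suc)
  then have "map (\<lambda>k. x (Suc k)) [0..<m] = map x [Suc 0..<m] @ [x 0]"
    using closed m' by simp
  then have "mset (map (\<lambda>k. x (Suc k)) [0..<m]) = mset (map x [0..<m])"
    using m' by (simp add: upt_conv_Cons del: upt_Suc)
  moreover have "distinct (map x [0..<m])"
    using bij by (simp add: distinct_map bij_betw_def lessThan_atLeast0)
  ultimately have "distinct (map (\<lambda>k. x (Suc k)) [0..<m])"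
    using mset_eq_imp_distinct_iff by blast
  then have "cycle ?p"
    unfolding cycle_def awalk_def using cas ne x0 arcs heads by auto
  then show ?thesis
    unfolding hamilton_cycle_def tails
    using m bij by (auto simp: bij_betw_def lessThan_atLeast0)
qed

text \<open>The shift by 1 makes \<open>m\<close>, not 0, represent the zero class, matching the
  vertex set \<open>{1..m}\<close>.\<close>

definition residue_rep :: "nat \<Rightarrow> int \<Rightarrow> nat" where
  "residue_rep m z = nat ((z - 1) mod int m) + 1"

lemma residue_rep_in: "0 < m \<Longrightarrow> residue_rep m z \<in> {1..m}"
  using pos_mod_bound[of "int m" "z - 1"] by (simp add: residue_rep_def nat_less_iff Suc_le_eq)

lemma cong_residue_rep:
  assumes "0 < m"
  shows "[int (residue_rep m z) = z] (mod int m)"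
proof -
  have "int (residue_rep m z) = (z - 1) mod int m + 1"
    using assms by (simp add: residue_rep_def)
  then show ?thesis by (simp add: cong_def mod_simps)
qed

lemma residue_rep_eq_iff:
  assumes "0 < m"
  shows "residue_rep m y = residue_rep m z \<longleftrightarrow> [y = z] (mod int m)"
proof
  assume "residue_rep m y = residue_rep m z"
  then show "[y = z] (mod int m)"
    using cong_residue_rep[OF assms] by (metis cong_sym cong_trans)
next
  assume "[y = z] (mod int m)"
  then have "(y - 1) mod int m = (z - 1) mod int m"
    by (metis cong_def cong_diff cong_refl)
  then show "residue_rep m y = residue_rep m z" by (simp add: residue_rep_def)
qed

lemma prime_sum_graph_arcI:
  assumes ij: "i \<in> {1..m}" "j \<in> {1..m}" and m: "even m"
    and p: "p \<in> {1..m}" "odd p" "prime p \<or> p = 1" "prime (m + p)"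
    and cong: "[int i + int j = int p] (mod int m)"
  shows "(i, j) \<in> parcs (prime_sum_graph m)"
proof -
  from cong obtain t where t: "int i + int j = int p + int m * t"
    by (metis cong_iff_lin cong_sym)
  have "1 \<le> int i" "int i \<le> int m" "1 \<le> int j" "int j \<le> int m" "1 \<le> int p" "int p \<le> int m"
    using ij p(1) by auto
  \<comment> \<open>The sum \<open>i + j\<close> lies between 2 and \<open>2 * m\<close> and
    \<open>p\<close> between 1 and \<open>m\<close>, so only the multiples 0 and \<open>m\<close>
    can separate them.\<close>
  then have "int m * t < int m * 2" "int m * (-1) < int m * t"
    using t by linarith+
  then have "t < 2" "-1 < t"
    by (auto simp only: mult_less_cancel_left)
  then consider "t = 0" | "t = 1" by linarith
  then have sum: "i + j = p \<or> i + j = m + p"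
    using t by cases auto
  \<comment> \<open>For \<open>p = 1\<close> the case \<open>i + j = p\<close> is impossible, as
    \<open>i + j\<close> is at least 2.\<close>
  then have "prime (i + j)" using p ij by auto
  moreover have "i \<noteq> j"
    using sum m p(2) by (metis even_add odd_add)
  ultimately show ?thesis using ij by (simp add: prime_sum_graph_def)
qed

text \<open>Closed form, over the integers, of the orbit of 0 under alternating reflections with
  sums \<open>p\<close> and \<open>p + d\<close>, the former applied first.\<close>

definition zigzag :: "int \<Rightarrow> int \<Rightarrow> nat \<Rightarrow> int" where
  "zigzag p d k = (if even k then int (k div 2) * d else p - int (k div 2) * d)"

lemma zigzag_add_Suc: "zigzag p d k + zigzag p d (Suc k) = (if even k then p else p + d)"
  by (auto simp: zigzag_def algebra_simps elim!: evenE oddE)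

lemma even_zigzag_iff: "odd p \<Longrightarrow> even d \<Longrightarrow> even (zigzag p d k) \<longleftrightarrow> even k"
  by (simp add: zigzag_def)

text \<open>The modulus is even, so parity separates even from odd indices. Within one parity, terms
  differ by a multiple of \<open>2 * e\<close>; cancelling 2 and the unit \<open>e\<close> modulo
  \<open>n\<close> leaves half-indices below \<open>n\<close> that agree modulo
  \<open>n\<close>.\<close>

lemma zigzag_inj:
  assumes p: "odd p" and d: "d = 2 * e" "coprime e (int n)"
    and kl: "k < 2 * n" "l < 2 * n"
    and cong: "[zigzag p d k = zigzag p d l] (mod (2 * int n))"
  shows "k = l"
proof -
  have "even (zigzag p d k) \<longleftrightarrow> even (zigzag p d l)"
    using cong by (metis cong_dvd_iff cong_dvd_modulus dvd_triv_left)
  then have par: "even k \<longleftrightarrow> even l"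
    using even_zigzag_iff p d(1) by simp
  have "2 * int n dvd (zigzag p d k - zigzag p d l)"
    using cong by (simp add: cong_iff_dvd_diff)
  \<comment> \<open>For odd indices the difference has the opposite sign, hence
    \<open>dvd_minus_iff\<close>.\<close>
  then have "2 * int n dvd 2 * ((int (k div 2) - int (l div 2)) * e)"
    using par d(1) dvd_minus_iff[of "2 * int n" "zigzag p d k - zigzag p d l"]
    by (cases "even k") (simp_all add: zigzag_def algebra_simps)
  then have "int n dvd (int (k div 2) - int (l div 2)) * e"
    by simp
  then have "int n dvd int (k div 2) - int (l div 2)"
    using d(2) by (simp add: coprime_dvd_mult_left_iff coprime_commute)
  moreover have "\<bar>int (k div 2) - int (l div 2)\<bar> < int n"
    using kl by (auto simp: abs_less_iff)
  ultimately have "k div 2 = l div 2"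
    using zdvd_imp_le[of "int n" "\<bar>int (k div 2) - int (l div 2)\<bar>"] by fastforce
  then show ?thesis
    using par by (metis even_two_times_div_two odd_two_times_div_two_succ)
qed

theorem theorem3:
  fixes n p\<^sub>1 p\<^sub>2 :: nat
  assumes "n \<ge> 2"
    and "p\<^sub>1 \<in> {1..2 * n}" and "p\<^sub>2 \<in> {1..2 * n}" and "p\<^sub>1 < p\<^sub>2"
    and "prime p\<^sub>2" and "prime p\<^sub>1 \<or> p\<^sub>1 = 1"
    and "prime (2 * n + p\<^sub>1)" and "prime (2 * n + p\<^sub>2)"
    and "gcd ((p\<^sub>2 - p\<^sub>1) div 2) n = 1"
  shows "\<exists>c. pre_digraph.hamilton_cycle (with_proj (prime_sum_graph (2 * n))) c"
proof -
  define m e where "m = 2 * n" and "e = (p\<^sub>2 - p\<^sub>1) div 2"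
  define d where "d = 2 * int e"
  define x where "x k = residue_rep m (zigzag (int p\<^sub>1) d k)" for k
  have m: "0 < m" "4 \<le> m" "even m" using assms(1) by (auto simp: m_def)
  \<comment> \<open>The primes \<open>2 * n + p\<^sub>1\<close> and \<open>2 * n + p\<^sub>2\<close>
    exceed 2; this also covers \<open>p\<^sub>1 = 1\<close> and rules out
    \<open>p\<^sub>2 = 2\<close>.\<close>
  have odd: "odd p\<^sub>1" "odd p\<^sub>2"
    using assms(1,7,8) prime_odd_nat[of "2 * n + p\<^sub>1"] prime_odd_nat[of "2 * n + p\<^sub>2"] by auto
  then have "p\<^sub>2 = p\<^sub>1 + 2 * e"
    using assms(4) by (simp add: e_def)
  then have p2: "int p\<^sub>2 = int p\<^sub>1 + d"
    by (simp add: d_def)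
  have cop: "coprime (int e) (int n)"
    using assms(9) by (simp add: e_def coprime_iff_gcd_eq_1)
  have x_in: "x k \<in> {1..m}" for k
    unfolding x_def using residue_rep_in[OF m(1)] .
  have arc: "(x k, x (Suc k)) \<in> parcs (prime_sum_graph m)" for k
  proof -
    have "[int (x k) + int (x (Suc k))
        = zigzag (int p\<^sub>1) d k + zigzag (int p\<^sub>1) d (Suc k)] (mod int m)"
      unfolding x_def by (intro cong_add cong_residue_rep m(1))
    then have cong: "[int (x k) + int (x (Suc k)) = int (if even k then p\<^sub>1 else p\<^sub>2)] (mod int m)"
      by (simp add: zigzag_add_Suc p2 split: if_splits)
    show ?thesis
      by (rule prime_sum_graph_arcI[OF x_in x_in m(3) _ _ _ _ cong])
        (use assms odd in \<open>auto simp: m_def\<close>)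
  qed
  \<comment> \<open>The walk closes after \<open>n\<close> translations by \<open>d\<close>, since
    \<open>n * d = m * e\<close>.\<close>
  have "x m = x 0"
    unfolding x_def residue_rep_eq_iff[OF m(1)]
    by (simp add: zigzag_def m_def d_def cong_0_iff)
  moreover have "inj_on x {..<m}"
  proof (rule inj_onI)
    fix k l assume kl: "k \<in> {..<m}" "l \<in> {..<m}" and "x k = x l"
    then have "[zigzag (int p\<^sub>1) d k = zigzag (int p\<^sub>1) d l] (mod (2 * int n))"
      unfolding x_def residue_rep_eq_iff[OF m(1)] by (simp add: m_def)
    from zigzag_inj[OF _ d_def cop _ _ this] show "k = l"
      using kl odd by (simp add: m_def)
  qed
  then have "bij_betw x {..<m} {1..m}"
    using x_in by (intro bij_betw_imageI card_subset_eq) (auto simp: card_image)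
  ultimately have "pre_digraph.hamilton_cycle (with_proj (prime_sum_graph m))
      (map (\<lambda>k. (x k, x (Suc k))) [0..<m])"
    using m arc by (intro pre_digraph.hamilton_cycleI[where x = x])
      (auto simp: prime_sum_graph_def)
  then show ?thesis unfolding m_def by blast
qed

end
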